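(* In the setting of the context, let $\theta^\star\in\mathrm{int}(\Theta_B)$ and let $\hat\theta:\mathcal Y_N\to\mathbb R^{d_\theta}$ be any estimator of $\theta$ that is locally unbiased at $\theta^\star$ (that is, a locally unbiased estimator of $h(\theta)=\theta$ at $\theta^\star$). Then: (i) for every $\alpha\in\mathcal E_s$, with $h(\theta)=\mathbf q_\alpha^\top\theta$, the statistic $\mathbf q_\alpha^\top\hat\theta$ is a locally unbiased estimator of $h(\theta)$ at $\theta^\star$, and $$\mathbb E_{\theta^\star}^{(N)}\big[|\mathbf q_\alpha^\top(\hat\theta-\theta^\star)|^2\big]\ \ge\ \frac{\mathbf q_\alpha^\top\mathcal I(\theta^\star)^\dagger\mathbf q_\alpha}{N};$$ (ii) if $\mathcal I(\theta^\star)\succ\mathbf 0$, then $$\mathbb E_{\theta^\star}^{(N)}\big[\|\hat\theta-\theta^\star\|_2^2\big]\ \ge\ \frac{\mathrm{tr}(\mathcal I(\theta^\star)^{-1})}{N}.$$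
   Context: Model (Bradley–Terry–Luce with linear-in-parameter utility). Fix an integer $d\ge2$, feature vectors $\phi(\mathbf x_1),\dots,\phi(\mathbf x_d)\in\mathbb R^p$, the matrix $\mathfrak A\in\mathbb R^{d\times p}$ with rows $\phi(\mathbf x_i)^\top$, a scale $\sigma>0$, and a consistent linear system $\mathbf A\mathbf w=\mathbf b$. Let $d_\theta=p-\mathrm{rank}(\mathbf A)\ge1$, let $\mathbf V\in\mathbb R^{p\times d_\theta}$ have orthonormal columns spanning $\mathrm{Null}(\mathbf A)$, and $\mathbf w_o=\mathbf A^\dagger\mathbf b$. Design: a nonempty set $\mathcal E_s\subseteq\{(i,j):1\le i<j\le d\}$ and integers $n_\alpha\ge1$; $N=\sum_{\alpha\in\mathcal E_s}n_\alpha$. For $\alpha=(i,j)$: $\mathbf a_\alpha=\mathfrak A^\top(\mathbf e_i-\mathbf e_j)$, $\mathbf q_\alpha=\mathbf V^\top\mathbf a_\alpha$, $\eta_\alpha(\theta)=(\mathbf w_o^\top\mathbf a_\alpha+\mathbf q_\alpha^\top\theta)/\sigma$. Responses: $Y^{(N)}=(Y_\alpha^{(t)})_{\alpha\in\mathcal E_s,t\in[n_\alpha]}\in\mathcal Y_N:=\{0,1\}^N$. Under $\mathbb P_\theta^{(N)}$ (expectation $\mathbb E_\theta^{(N)}$) the coordinates are independent and $Y_\alpha^{(t)}$ is Bernoulli with success probability $1/(1+e^{-\eta_\alpha(\theta)})$. Parameter set: for $B>1$, $\Theta_B=\{\theta\in\mathbb R^{d_\theta}:|\eta_\alpha(\theta)|\le\log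 B\ \forall\alpha\in\mathcal E_s\}$. Fisher information matrix: with $\Psi(\eta)=\log(1+e^\eta)$, $\ \mathcal I(\theta)=\frac1{N\sigma^2}\sum_{\alpha\in\mathcal E_s}n_\alpha\Psi''(\eta_\alpha(\theta))\mathbf q_\alpha\mathbf q_\alpha^\top$. $\dagger$ denotes the Moore–Penrose pseudoinverse. Local unbiasedness: for a $C^1$ map $h:\Theta_B\to\mathbb R^q$ ($q\le d_\theta$), an estimator $\hat\psi:\mathcal Y_N\to\mathbb R^q$ is locally unbiased for $h(\theta)$ at $\theta^\star$ if $\mathbb E_{\theta^\star}^{(N)}[\hat\psi]=h(\theta^\star)$ and $\nabla_\theta\mathbb E_\theta^{(N)}[\hat\psi]\big|_{\theta=\theta^\star}=\nabla h(\theta^\star)$, where the $k$-th column of $\nabla h$ is the gradient of the $k$-th component of $h$. *)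

theory Defs
  imports "HOL-Analysis.Analysis" "HOL-Probability.Probability"
begin

section \<open>Moore--Penrose pseudoinverse\<close>

definition is_pinv :: "real^'n^'m \<Rightarrow> real^'m^'n \<Rightarrow> bool" where
  "is_pinv A X \<longleftrightarrow> A ** X ** A = A \<and> X ** A ** X = X \<and>
     transpose (A ** X) = A ** X \<and> transpose (X ** A) = X ** A"

definition pinv :: "real^'n^'m \<Rightarrow> real^'m^'n" where
  "pinv A = (THE X. is_pinv A X)"

lemma is_pinv_unique:
  fixes A :: "real^'n^'m"
  assumes X: "is_pinv A X" and Y: "is_pinv A Y"
  shows "X = Y"
proof -
  have AXY: "A ** X = A ** Y"
  proof -
    have "A ** X = (A ** Y ** A) ** X"
      using Y by (simp add: is_pinv_def)
    also have "\<dots> = (A ** Y) ** (A ** X)"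
      by (simp add: matrix_mul_assoc)
    also have "\<dots> = transpose (A ** Y) ** transpose (A ** X)"
      using X Y by (simp add: is_pinv_def)
    also have "\<dots> = transpose (A ** X ** A ** Y)"
      by (simp add: matrix_transpose_mul matrix_mul_assoc)
    also have "\<dots> = A ** Y"
      using X Y by (simp add: is_pinv_def)
    finally show ?thesis .
  qed
  have XYA: "X ** A = Y ** A"
  proof -
    have "X ** A = X ** (A ** Y ** A)"
      using Y by (simp add: is_pinv_def)
    also have "\<dots> = (X ** A) ** (Y ** A)"
      by (simp add: matrix_mul_assoc)
    also have "\<dots> = transpose (X ** A) ** transpose (Y ** A)"
      using X Y by (simp add: is_pinv_def)
    also have "\<dots> = transpose (Y ** (A ** X ** A))"
      by (simp add: matrix_transpose_mul matrix_mul_assoc)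
    also have "\<dots> = Y ** A"
      using X Y by (simp add: is_pinv_def)
    finally show ?thesis .
  qed
  have "X = X ** A ** X"
    using X by (simp add: is_pinv_def)
  also have "\<dots> = Y ** (A ** X)"
    by (simp add: XYA matrix_mul_assoc)
  also have "\<dots> = Y ** A ** Y"
    by (simp add: AXY matrix_mul_assoc)
  also have "\<dots> = Y"
    using Y by (simp add: is_pinv_def)
  finally show ?thesis .
qed

lemma is_pinv_exists:
  fixes A :: "real^'n^'m"
  shows "\<exists>X. is_pinv A X"
proof -
  define T where "T = transpose A"
  have adj: "(T *v y) \<bullet> x = y \<bullet> (A *v x)" for x y
    by (simp add: T_def dot_lmul_matrix)
  have adj': "x \<bullet> (T *v y) = (A *v x) \<bullet> y" for x y
    by (metis adj inner_commute)
  have ker: "A *v u = 0" if "T *v (A *v u) = 0" for u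
    using adj[of "A *v u" u] that by simp
  have ex: "\<exists>v. (\<exists>w. v = T *v w) \<and> T *v (y - A *v v) = 0" for y
  proof -
    have sA: "subspace (range ((*v) A))" and sT: "subspace (range ((*v) T))"
      by (simp_all add: linear_subspace_image matrix_vector_mul_linear)
    obtain y1 z where y1: "y1 \<in> span (range ((*v) A))"
        and z: "\<And>w. w \<in> span (range ((*v) A)) \<Longrightarrow> orthogonal z w" and y: "y = y1 + z"
      using orthogonal_subspace_decomp_exists[of "range ((*v) A)" y] by metis
    have "y1 \<in> range ((*v) A)"
      using y1 sA by (metis span_eq_iff)
    then obtain u where u: "y1 = A *v u"
      by auto
    obtain v w where v: "v \<in> span (range ((*v) T))"
        and w: "\<And>x. x \<in> span (range ((*v) T)) \<Longrightarrow> orthogonal w x" and uv: "u = v + w"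
      using orthogonal_subspace_decomp_exists[of "range ((*v) T)" u] by metis
    have "v \<in> range ((*v) T)"
      using v sT by (metis span_eq_iff)
    then obtain t where t: "v = T *v t"
      by auto
    have "w \<bullet> (T *v (A *v w)) = 0"
      using w[OF span_base, of "T *v (A *v w)"] by (auto simp: orthogonal_def)
    then have Aw: "A *v w = 0"
      by (simp only: adj' inner_eq_zero_iff)
    have "z \<bullet> (A *v x) = 0" for x
      using z[OF span_base, of "A *v x"] by (auto simp: orthogonal_def)
    then have "T *v z = 0"
      using adj[of z "T *v z"] by simp
    moreover have "y - A *v v = z"
      by (simp add: y u uv Aw matrix_vector_right_distrib)
    ultimately show ?thesis
      using t by auto
  qed
  define g where "g y = (SOME v. (\<exists>w. v = T *v w) \<and> T *v (y - A *v v) = 0)" for y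
  have g: "(\<exists>w. g y = T *v w) \<and> T *v (y - A *v g y) = 0" for y
    unfolding g_def by (rule someI_ex[OF ex])
  have g_eq: "g y = v" if v: "\<exists>w. v = T *v w" "T *v (y - A *v v) = 0" for y v
  proof -
    obtain w w' where w: "v = T *v w" "g y = T *v w'"
      using v g by blast
    have "T *v (A *v (g y - v)) = T *v (y - A *v v) - T *v (y - A *v g y)"
      by (simp add: matrix_vector_mult_diff_distrib)
    then have "A *v (g y - v) = 0"
      using v g ker by simp
    then have "(g y - v) \<bullet> (T *v (w' - w)) = 0"
      by (simp add: adj')
    then show ?thesis
      by (simp add: w matrix_vector_mult_diff_distrib)
  qed
  have "linear g"
  proof (rule linearI)
    fix x y
    obtain a b where "g x = T *v a" "g y = T *v b" using g by blast
    then have "\<exists>w. g x + g y = T *v w"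
      by (metis matrix_vector_right_distrib)
    moreover have "T *v (x + y - A *v (g x + g y)) = T *v (x - A *v g x) + T *v (y - A *v g y)"
      by (simp add: matrix_vector_mult_diff_distrib matrix_vector_right_distrib)
    ultimately show "g (x + y) = g x + g y"
      using g by (intro g_eq) auto
  next
    fix c x
    obtain a where "g x = T *v a" using g by blast
    then have "\<exists>w. c *\<^sub>R g x = T *v w"
      by (metis matrix_vector_mult_scaleR)
    moreover have "T *v (c *\<^sub>R x - A *v (c *\<^sub>R g x)) = c *\<^sub>R (T *v (x - A *v g x))"
      by (simp add: matrix_vector_mult_diff_distrib matrix_vector_mult_scaleR scaleR_diff_right)
    ultimately show "g (c *\<^sub>R x) = c *\<^sub>R g x"
      using g by (intro g_eq) auto
  qed
  then have M: "matrix g *v y = g y" for y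
    by (simp add: matrix_works)
  have res: "(y - A *v g y) \<bullet> (A *v x) = 0" for x y
    using g[of y] adj[of "y - A *v g y" x] by simp
  have AgA: "A *v g (A *v x) = A *v x" for x
    using ker[of "x - g (A *v x)"] g[of "A *v x"] by (simp add: matrix_vector_mult_diff_distrib)
  have gAg: "g (A *v g y) = g y" for y
    using g[of y] by (intro g_eq) auto
  have sym1: "(A *v g y) \<bullet> z = y \<bullet> (A *v g z)" for y z
    using res[of z "g y"] res[of y "g z"] by (simp add: inner_diff_left inner_commute[of "A *v g y"])
  have res2: "(x - g (A *v x)) \<bullet> g y = 0" for x y
  proof -
    obtain w where w: "g y = T *v w" using g by blast
    show ?thesis
      by (simp add: w adj' matrix_vector_mult_diff_distrib AgA)
  qed
  have sym2: "g (A *v x) \<bullet> z = x \<bullet> g (A *v z)" for x z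
    using res2[of x "A *v z"] res2[of z "A *v x"]
    by (simp add: inner_diff_left inner_commute[of "g (A *v x)"])
  have symI: "transpose B = B" if "\<And>x y. (B *v x) \<bullet> y = x \<bullet> (B *v y)" for B :: "real^'k^'k"
  proof -
    have "(transpose B *v x) \<bullet> y = (B *v x) \<bullet> y" for x y
      by (simp add: dot_lmul_matrix that)
    then show ?thesis
      by (metis matrix_eq vector_eq_rdot)
  qed
  have "is_pinv A (matrix g)"
    unfolding is_pinv_def
    by (intro conjI symI)
       (simp_all add: matrix_eq matrix_vector_mul_assoc[symmetric] M AgA gAg sym1 sym2)
  then show ?thesis ..
qed

lemma is_pinv_pinv: "is_pinv A (pinv A)"
  unfolding pinv_def using is_pinv_exists is_pinv_unique by (metis theI)


section \<open>Bradley--Terry--Luce design with linear utility\<close>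

text \<open>Items are indexed by a finite linearly ordered type, so that a comparison is a pair
  \<open>(i, j)\<close> with \<open>i < j\<close>; the design is a set \<open>Es\<close> of comparisons with multiplicities \<open>n\<close>.\<close>

definition feature_matrix :: "('x \<Rightarrow> real^'p) \<Rightarrow> ('d \<Rightarrow> 'x) \<Rightarrow> real^'p^'d" where
  "feature_matrix \<phi> x = (\<chi> i. \<phi> (x i))"

definition contrast :: "real^'p^'d \<Rightarrow> 'd \<times> 'd \<Rightarrow> real^'p" where
  "contrast F \<alpha> = transpose F *v (axis (fst \<alpha>) 1 - axis (snd \<alpha>) 1)"

definition sample_size :: "('d \<times> 'd) set \<Rightarrow> ('d \<times> 'd \<Rightarrow> nat) \<Rightarrow> nat" where
  "sample_size Es n = (\<Sum>\<alpha>\<in>Es. n \<alpha>)"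

text \<open>A response vector is a function on pairs \<open>(\<alpha>, t)\<close>, with \<open>True\<close> for the response 1. The law
  is supported on functions that are \<open>False\<close> outside the index set, which is a copy of
  \<open>{0,1}\<^sup>N\<close>; the values of an estimator elsewhere do not matter.\<close>

definition btl_pmf ::
  "('d \<times> 'd) set \<Rightarrow> ('d \<times> 'd \<Rightarrow> nat) \<Rightarrow> ('d \<times> 'd \<Rightarrow> real^'k \<Rightarrow> real) \<Rightarrow> real^'k \<Rightarrow>
     (('d \<times> 'd) \<times> nat \<Rightarrow> bool) pmf" where
  "btl_pmf Es n \<eta> \<theta> =
     Pi_pmf (SIGMA \<alpha>:Es. {1..n \<alpha>}) False (\<lambda>(\<alpha>, t). bernoulli_pmf (1 / (1 + exp (- \<eta> \<alpha> \<theta>))))"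

definition param_set :: "('d \<times> 'd) set \<Rightarrow> ('d \<times> 'd \<Rightarrow> real^'k \<Rightarrow> real) \<Rightarrow> real \<Rightarrow> (real^'k) set" where
  "param_set Es \<eta> B = {\<theta>. \<forall>\<alpha>\<in>Es. \<bar>\<eta> \<alpha> \<theta>\<bar> \<le> ln B}"

definition log_partition :: "real \<Rightarrow> real" where
  "log_partition s = ln (1 + exp s)"

definition outer_prod :: "real^'k \<Rightarrow> real^'k \<Rightarrow> real^'k^'k" where
  "outer_prod u v = (\<chi> i j. u $ i * v $ j)"

definition fisher_info ::
  "('d \<times> 'd) set \<Rightarrow> ('d \<times> 'd \<Rightarrow> nat) \<Rightarrow> real \<Rightarrow> ('d \<times> 'd \<Rightarrow> real^'k) \<Rightarrow>
     ('d \<times> 'd \<Rightarrow> real^'k \<Rightarrow> real) \<Rightarrow> real^'k \<Rightarrow> real^'k^'k" where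
  "fisher_info Es n \<sigma> q \<eta> \<theta> =
     (1 / (real (sample_size Es n) * \<sigma>\<^sup>2)) *\<^sub>R
       (\<Sum>\<alpha>\<in>Es. (real (n \<alpha>) * (deriv ^^ 2) log_partition (\<eta> \<alpha> \<theta>)) *\<^sub>R outer_prod (q \<alpha>) (q \<alpha>))"

definition pos_def :: "real^'k^'k \<Rightarrow> bool" where
  "pos_def M \<longleftrightarrow> transpose M = M \<and> (\<forall>v. v \<noteq> 0 \<longrightarrow> v \<bullet> (M *v v) > 0)"


section \<open>Local unbiasedness\<close>

definition C1_map_on :: "(real^'k) set \<Rightarrow> (real^'k \<Rightarrow> real^'q) \<Rightarrow> bool" where
  "C1_map_on S h \<longleftrightarrow>
     (\<exists>J :: real^'k \<Rightarrow> real^'k^'q. continuous_on S J \<and>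
        (\<forall>\<theta>\<in>S. (h has_derivative (*v) (J \<theta>)) (at \<theta> within S)))"

definition has_gradient_matrix :: "(real^'k \<Rightarrow> real^'q) \<Rightarrow> real^'k \<Rightarrow> real^'q^'k \<Rightarrow> bool" where
  "has_gradient_matrix h \<theta> G \<longleftrightarrow> (\<forall>k. GDERIV (\<lambda>\<theta>'. h \<theta>' $ k) \<theta> :> column k G)"

text \<open>The gradients are taken in the full parameter space, so for a map \<open>h\<close> that only matters on
  \<open>\<Theta>\<close> the notion is meaningful at interior points of \<open>\<Theta>\<close>.\<close>

definition locally_unbiased ::
  "(real^'k) set \<Rightarrow> (real^'k \<Rightarrow> 'y pmf) \<Rightarrow> (real^'k \<Rightarrow> real^'q) \<Rightarrow> ('y \<Rightarrow> real^'q) \<Rightarrow> real^'k \<Rightarrow> bool"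
  where
  "locally_unbiased \<Theta> P h \<psi> \<theta> \<longleftrightarrow>
     CARD('q) \<le> CARD('k) \<and> C1_map_on \<Theta> h \<and>
     measure_pmf.expectation (P \<theta>) \<psi> = h \<theta> \<and>
     (\<exists>G. has_gradient_matrix (\<lambda>\<theta>'. measure_pmf.expectation (P \<theta>') \<psi>) \<theta> G \<and>
          has_gradient_matrix h \<theta> G)"

end

theory Submission
  imports Defs
begin

text \<open>
  The score of the model in a direction \<open>v\<close> is \<open>T - E T\<close>, where the statistic \<open>T\<close> is linear in the
  responses, so that differentiating \<open>E f\<close> along \<open>v\<close> gives \<open>E (f * (T - E T))\<close>. With \<open>f = T\<close> this
  yields \<open>E (T - E T)\<^sup>2 = N (v \<bullet> \<I> v)\<close> without computing covariances of the responses, and an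
  unbiased estimator of the linear function with gradient \<open>u\<close> has covariance \<open>u \<bullet> v\<close> with the score.
  Expanding the second moment of the error minus the score gives the lower bound
  \<open>2 (u \<bullet> v) - N (v \<bullet> \<I> v)\<close> on its mean squared error, and \<open>v = \<I>\<^sup>\<dagger> u / N\<close> is the optimal choice. Part
  (ii) is the sum of these bounds over the coordinate vectors.
\<close>

section \<open>Logistic regression on finitely many independent responses\<close>

definition logistic :: "real \<Rightarrow> real" where
  "logistic t = 1 / (1 + exp (- t))"

lemma logistic_bounds: "0 \<le> logistic t" "logistic t \<le> 1"
  by (simp_all add: logistic_def divide_le_eq_1 add_pos_pos)

lemma has_field_derivative_logistic:
  "(logistic has_field_derivative logistic t * (1 - logistic t)) (at t)"
proof -
  have "1 + exp (- t) \<noteq> 0"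
    by (metis add_pos_pos exp_gt_zero less_numeral_extra(3) zero_less_one)
  then show ?thesis
    unfolding logistic_def[abs_def]
    by (auto intro!: derivative_eq_intros simp: field_simps power2_eq_square)
qed

lemma has_derivative_logistic_affine:
  "((\<lambda>\<theta>. logistic (c + w \<bullet> \<theta>)) has_derivative
    (\<lambda>h. logistic (c + w \<bullet> \<theta>) * (1 - logistic (c + w \<bullet> \<theta>)) * (w \<bullet> h))) (at \<theta>)"
proof -
  have "((\<lambda>\<theta>. c + w \<bullet> \<theta>) has_derivative (\<lambda>h. w \<bullet> h)) (at \<theta>)"
    by (auto intro!: derivative_eq_intros)
  from has_derivative_compose[OF this has_field_derivative_logistic[unfolded has_field_derivative_def]]
  show ?thesis .
qed

text \<open>The first derivative of \<open>log_partition\<close> is \<open>logistic\<close>, so the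
  second is the variance of a Bernoulli response: this is how the Fisher information meets the
  responses.\<close>

lemma deriv2_log_partition:
  "(deriv ^^ 2) log_partition t = logistic t * (1 - logistic t)"
proof -
  have "(log_partition has_field_derivative logistic s) (at s)" for s
  proof -
    have "1 + exp s > 0" by (simp add: add_pos_pos)
    then show ?thesis
      unfolding log_partition_def[abs_def] logistic_def
      by (auto intro!: derivative_eq_intros simp: exp_minus field_simps)
  qed
  then have "deriv log_partition = logistic"
    by (auto intro: DERIV_imp_deriv)
  then show ?thesis
    using has_field_derivative_logistic[of t] by (simp add: numeral_2_eq_2 DERIV_imp_deriv)
qed

text \<open>Each single response has its own index \<open>z\<close>, with offset \<open>c z\<close>
  and covariate \<open>w z\<close>. Multiplicities of comparisons and the scale thus disappear from
  the statistical argument.\<close>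

definition logit_pmf ::
  "'i set \<Rightarrow> ('i \<Rightarrow> real) \<Rightarrow> ('i \<Rightarrow> 'a::euclidean_space) \<Rightarrow> 'a \<Rightarrow> ('i \<Rightarrow> bool) pmf" where
  "logit_pmf Z c w \<theta> = Pi_pmf Z False (\<lambda>z. bernoulli_pmf (logistic (c z + w z \<bullet> \<theta>)))"

text \<open>The derivative of the log-likelihood in the direction \<open>v\<close>: each response
  contributes its residual times the slope of its linear predictor.\<close>

definition logit_score ::
  "'i set \<Rightarrow> ('i \<Rightarrow> real) \<Rightarrow> ('i \<Rightarrow> 'a::euclidean_space) \<Rightarrow> 'a \<Rightarrow> 'a \<Rightarrow> ('i \<Rightarrow> bool) \<Rightarrow> real" where
  "logit_score Z c w \<theta> v y = (\<Sum>z\<in>Z. (of_bool (y z) - logistic (c z + w z \<bullet> \<theta>)) * (w z \<bullet> v))"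

lemma set_logit_pmf:
  assumes "finite Z"
  shows "set_pmf (logit_pmf Z c w \<theta>) \<subseteq> PiE_dflt Z False (\<lambda>_. UNIV)"
  using assms set_Pi_pmf_subset'[of Z False] unfolding logit_pmf_def by (fastforce simp: PiE_dflt_def)

lemma finite_outcomes: "finite Z \<Longrightarrow> finite (PiE_dflt Z False (\<lambda>_. UNIV :: bool set))"
  by (rule finite_PiE_dflt) auto

lemma integrable_logit_pmf:
  fixes f :: "('i \<Rightarrow> bool) \<Rightarrow> 'b::{banach,second_countable_topology}"
  assumes "finite Z"
  shows "integrable (measure_pmf (logit_pmf Z c w \<theta>)) f"
  using assms by (meson finite_outcomes finite_subset integrable_measure_pmf_finite set_logit_pmf)

text \<open>The range of summation is finite and does not depend on \<open>\<theta>\<close>, so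
  expectations can be differentiated term by term.\<close>

lemma expectation_logit_pmf:
  fixes f :: "('i \<Rightarrow> bool) \<Rightarrow> 'b::{banach,second_countable_topology}"
  assumes "finite Z"
  shows "measure_pmf.expectation (logit_pmf Z c w \<theta>) f =
    (\<Sum>y\<in>PiE_dflt Z False (\<lambda>_. UNIV). pmf (logit_pmf Z c w \<theta>) y *\<^sub>R f y)"
  using assms set_logit_pmf[OF assms] by (intro integral_measure_pmf) (auto simp: finite_outcomes)

lemma has_derivative_pmf_logit:
  fixes w :: "'i \<Rightarrow> 'a::euclidean_space"
  assumes "finite Z" and y: "y \<in> PiE_dflt Z False (\<lambda>_. UNIV)"
  shows "((\<lambda>\<theta>. pmf (logit_pmf Z c w \<theta>) y) has_derivative
    (\<lambda>v. pmf (logit_pmf Z c w \<theta>) y * logit_score Z c w \<theta> v y)) (at \<theta>)"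
proof -
  let ?p = "\<lambda>z \<theta>. logistic (c z + w z \<bullet> \<theta>)"
  let ?f = "\<lambda>z \<theta>. if y z then ?p z \<theta> else 1 - ?p z \<theta>"
  have pmf: "pmf (logit_pmf Z c w \<theta>) y = (\<Prod>z\<in>Z. ?f z \<theta>)" for \<theta>
  proof -
    have "pmf (logit_pmf Z c w \<theta>) y = (\<Prod>z\<in>Z. pmf (bernoulli_pmf (?p z \<theta>)) (y z))"
      unfolding logit_pmf_def using assms by (intro pmf_Pi') (auto simp: PiE_dflt_def)
    also have "\<dots> = (\<Prod>z\<in>Z. ?f z \<theta>)"
      by (intro prod.cong refl) (auto simp: pmf_bernoulli_True pmf_bernoulli_False logistic_bounds)
    finally show ?thesis .
  qed
  \<comment> \<open>Since the logistic function has slope \<open>p * (1 - p)\<close>, both factors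
    \<open>p\<close> and \<open>1 - p\<close> reproduce themselves times the residual, which is
    \<open>1 - p\<close> or \<open>- p\<close>.\<close>
  have f: "((\<lambda>\<theta>. ?f z \<theta>) has_derivative
      (\<lambda>v. ?f z \<theta> * ((of_bool (y z) - ?p z \<theta>) * (w z \<bullet> v)))) (at \<theta>)" for z
    by (cases "y z") (auto intro!: derivative_eq_intros
        has_derivative_eq_rhs[OF has_derivative_logistic_affine] simp: fun_eq_iff algebra_simps)
  have "((\<lambda>\<theta>. \<Prod>z\<in>Z. ?f z \<theta>) has_derivative
      (\<lambda>v. \<Sum>z\<in>Z. ?f z \<theta> * ((of_bool (y z) - ?p z \<theta>) * (w z \<bullet> v)) * (\<Prod>j\<in>Z - {z}. ?f j \<theta>)))
      (at \<theta>)"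
    by (rule has_derivative_prod) (rule f)
  also have "(\<lambda>v. \<Sum>z\<in>Z. ?f z \<theta> * ((of_bool (y z) - ?p z \<theta>) * (w z \<bullet> v)) * (\<Prod>j\<in>Z - {z}. ?f j \<theta>)) =
      (\<lambda>v. (\<Prod>z\<in>Z. ?f z \<theta>) * logit_score Z c w \<theta> v y)"
    unfolding logit_score_def sum_distrib_left
    by (intro ext sum.cong refl) (simp add: prod.remove[OF \<open>finite Z\<close>] mult_ac)
  finally show ?thesis
    by (simp only: pmf)
qed

lemma has_derivative_expectation_logit:
  fixes w :: "'i \<Rightarrow> 'a::euclidean_space" and f :: "('i \<Rightarrow> bool) \<Rightarrow> real"
  assumes "finite Z"
  shows "((\<lambda>\<theta>. measure_pmf.expectation (logit_pmf Z c w \<theta>) f) has_derivative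
    (\<lambda>v. measure_pmf.expectation (logit_pmf Z c w \<theta>) (\<lambda>y. f y * logit_score Z c w \<theta> v y))) (at \<theta>)"
proof -
  let ?Y = "PiE_dflt Z False (\<lambda>_. UNIV :: bool set)"
  have "((\<lambda>\<theta>. \<Sum>y\<in>?Y. pmf (logit_pmf Z c w \<theta>) y * f y) has_derivative
      (\<lambda>v. \<Sum>y\<in>?Y. pmf (logit_pmf Z c w \<theta>) y * logit_score Z c w \<theta> v y * f y)) (at \<theta>)"
    by (intro has_derivative_sum has_derivative_mult_left has_derivative_pmf_logit[OF assms])
  then show ?thesis
    by (simp add: expectation_logit_pmf[OF assms] mult_ac)
qed

text \<open>The total mass is constantly 1; its derivative is the expected score.\<close>

lemma expectation_logit_score:
  assumes "finite Z"
  shows "measure_pmf.expectation (logit_pmf Z c w \<theta>) (logit_score Z c w \<theta> v) = 0"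
proof -
  have "((\<lambda>\<theta>. 1) has_derivative
      (\<lambda>v. measure_pmf.expectation (logit_pmf Z c w \<theta>) (logit_score Z c w \<theta> v))) (at \<theta>)"
    using has_derivative_expectation_logit[OF assms, of c w "\<lambda>_. 1" \<theta>] by simp
  then have "(\<lambda>v. measure_pmf.expectation (logit_pmf Z c w \<theta>) (logit_score Z c w \<theta> v)) = (\<lambda>v. 0)"
    by (rule has_derivative_unique) simp
  then show ?thesis
    by (rule fun_cong)
qed

text \<open>The mean \<open>m\<close> of \<open>T\<close> is differentiated twice over: directly
  from its formula, and as an expectation, which produces the score. Uniqueness of the derivative
  equates the results.\<close>

lemma expectation_logit_score_power2:
  fixes w :: "'i \<Rightarrow> 'a::euclidean_space" and c :: "'i \<Rightarrow> real"
  assumes "finite Z"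
  defines "p \<equiv> \<lambda>\<theta> z. logistic (c z + w z \<bullet> \<theta>)"
  shows "measure_pmf.expectation (logit_pmf Z c w \<theta>) (\<lambda>y. (logit_score Z c w \<theta> v y)\<^sup>2) =
    (\<Sum>z\<in>Z. p \<theta> z * (1 - p \<theta> z) * (w z \<bullet> v)\<^sup>2)"
proof -
  let ?E = "\<lambda>\<theta>. measure_pmf.expectation (logit_pmf Z c w \<theta>)"
  note int = integrable_logit_pmf[OF assms(1)]
  define T where "T y = (\<Sum>z\<in>Z. of_bool (y z) * (w z \<bullet> v))" for y :: "'i \<Rightarrow> bool"
  define m where "m \<theta> = (\<Sum>z\<in>Z. p \<theta> z * (w z \<bullet> v))" for \<theta>
  have score: "logit_score Z c w \<theta> v = (\<lambda>y. T y - m \<theta>)" for \<theta>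
    by (simp add: fun_eq_iff logit_score_def T_def m_def p_def sum_subtractf left_diff_distrib)
  have ET: "?E \<theta> T = m \<theta>" for \<theta>
    using expectation_logit_score[OF assms(1), of c w \<theta> v] by (simp add: score int)
  have p': "((\<lambda>\<theta>. p \<theta> z) has_derivative (\<lambda>h. p \<theta> z * (1 - p \<theta> z) * (w z \<bullet> h))) (at \<theta>)" for z
    unfolding p_def by (rule has_derivative_logistic_affine)
  have "(m has_derivative (\<lambda>h. \<Sum>z\<in>Z. p \<theta> z * (1 - p \<theta> z) * (w z \<bullet> h) * (w z \<bullet> v))) (at \<theta>)"
    unfolding m_def[abs_def] by (intro has_derivative_sum has_derivative_mult_left p')
  moreover have "(m has_derivative (\<lambda>h. ?E \<theta> (\<lambda>y. T y * logit_score Z c w \<theta> h y))) (at \<theta>)"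
    using has_derivative_expectation_logit[OF assms(1), of c w T \<theta>] by (simp add: ET)
  ultimately have "?E \<theta> (\<lambda>y. T y * logit_score Z c w \<theta> v y) =
      (\<Sum>z\<in>Z. p \<theta> z * (1 - p \<theta> z) * (w z \<bullet> v) * (w z \<bullet> v))"
    by (rule has_derivative_unique[THEN fun_cong, rotated])
  \<comment> \<open>One factor of the square is written as \<open>T y - m \<theta>\<close>; the part
    with the constant \<open>m \<theta>\<close> vanishes because the score is centred.\<close>
  moreover have "?E \<theta> (\<lambda>y. (logit_score Z c w \<theta> v y)\<^sup>2) =
      ?E \<theta> (\<lambda>y. T y * logit_score Z c w \<theta> v y - m \<theta> * logit_score Z c w \<theta> v y)"
    by (simp add: score power2_eq_square left_diff_distrib)
  ultimately show ?thesis
    by (simp add: int expectation_logit_score[OF assms(1)] power2_eq_square mult_ac)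
qed

text \<open>Nonnegativity of a square replaces the Cauchy-Schwarz inequality, so nothing is divided
  by the information, which may be singular. The centre \<open>m\<close> is arbitrary because the
  score has mean zero.\<close>

lemma logit_Cramer_Rao:
  fixes w :: "'i \<Rightarrow> 'a::euclidean_space" and c :: "'i \<Rightarrow> real" and f :: "('i \<Rightarrow> bool) \<Rightarrow> real"
  assumes "finite Z"
    and "GDERIV (\<lambda>\<theta>. measure_pmf.expectation (logit_pmf Z c w \<theta>) f) \<theta> :> u"
  defines "p \<equiv> \<lambda>z. logistic (c z + w z \<bullet> \<theta>)"
  shows "2 * (u \<bullet> v) - (\<Sum>z\<in>Z. p z * (1 - p z) * (w z \<bullet> v)\<^sup>2)
    \<le> measure_pmf.expectation (logit_pmf Z c w \<theta>) (\<lambda>y. (f y - m)\<^sup>2)"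
proof -
  let ?E = "measure_pmf.expectation (logit_pmf Z c w \<theta>)"
  let ?s = "logit_score Z c w \<theta> v"
  note int = integrable_logit_pmf[OF assms(1)]
  have cov: "?E (\<lambda>y. f y * ?s y) = u \<bullet> v"
  proof -
    have "(\<lambda>h. ?E (\<lambda>y. f y * logit_score Z c w \<theta> h y)) = (\<lambda>h. h \<bullet> u)"
      using has_derivative_expectation_logit[OF assms(1)] assms(2)[unfolded gderiv_def]
      by (rule has_derivative_unique)
    then show ?thesis
      by (simp add: fun_eq_iff inner_commute[of v])
  qed
  have "0 \<le> ?E (\<lambda>y. (f y - m - ?s y)\<^sup>2)"
    by simp
  also have "(\<lambda>y. (f y - m - ?s y)\<^sup>2) =
      (\<lambda>y. (f y - m)\<^sup>2 - 2 * (f y * ?s y) + 2 * m * ?s y + (?s y)\<^sup>2)"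
    by (simp add: fun_eq_iff power2_eq_square algebra_simps)
  also have "?E \<dots> = ?E (\<lambda>y. (f y - m)\<^sup>2) - 2 * (u \<bullet> v) + ?E (\<lambda>y. (?s y)\<^sup>2)"
    by (simp add: int cov expectation_logit_score[OF assms(1)])
  finally show ?thesis
    by (simp add: expectation_logit_score_power2[OF assms(1)] p_def)
qed


section \<open>Pseudoinverses of symmetric matrices\<close>

lemma pinv_unique: "is_pinv M X \<Longrightarrow> pinv M = X"
  using is_pinv_pinv is_pinv_unique by blast

text \<open>Transposing the Penrose equations of \<open>pinv M\<close> gives those of its transpose
  for the same \<open>M\<close>; uniqueness concludes.\<close>

lemma transpose_pinv:
  fixes M :: "real^'k^'k"
  assumes "transpose M = M"
  shows "transpose (pinv M) = pinv M"
proof -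
  have 1: "M ** pinv M ** M = M" "pinv M ** M ** pinv M = pinv M"
    "transpose (M ** pinv M) = M ** pinv M" "transpose (pinv M ** M) = pinv M ** M"
    using is_pinv_pinv[of M] by (auto simp: is_pinv_def)
  \<comment> \<open>Transposition exchanges the two projections \<open>M ** pinv M\<close> and
    \<open>pinv M ** M\<close>.\<close>
  have 2: "transpose (pinv M) ** M = M ** pinv M" "M ** transpose (pinv M) = pinv M ** M"
    using 1(3,4) by (simp_all add: matrix_transpose_mul assms)
  have "is_pinv M (transpose (pinv M))"
    unfolding is_pinv_def
  proof (intro conjI)
    show "M ** transpose (pinv M) ** M = M"
      using arg_cong[OF 1(1), of transpose] by (simp add: matrix_transpose_mul assms matrix_mul_assoc)
    show "transpose (pinv M) ** M ** transpose (pinv M) = transpose (pinv M)"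
      using arg_cong[OF 1(2), of transpose] by (simp add: matrix_transpose_mul assms matrix_mul_assoc)
  qed (simp_all only: 1 2)
  then show ?thesis
    by (rule pinv_unique[symmetric])
qed

lemma inner_pinv:
  fixes M :: "real^'k^'k"
  assumes "transpose M = M"
  shows "(pinv M *v u) \<bullet> (M *v (pinv M *v u)) = u \<bullet> (pinv M *v u)"
proof -
  have "(pinv M *v u) \<bullet> (M *v (pinv M *v u)) = u \<bullet> (pinv M *v (M *v (pinv M *v u)))"
    using dot_lmul_matrix[of u "pinv M" "M *v (pinv M *v u)"]
    by (simp add: transpose_matrix_vector[symmetric] transpose_pinv[OF assms])
  also have "pinv M *v (M *v (pinv M *v u)) = pinv M *v u"
    using is_pinv_pinv[of M] by (simp add: is_pinv_def matrix_vector_mul_assoc matrix_mul_assoc)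
  finally show ?thesis .
qed

lemma matrix_inv_eq_pinv:
  fixes M :: "real^'k^'k"
  assumes "invertible M"
  shows "matrix_inv M = pinv M"
proof -
  have "M ** matrix_inv M = mat 1 \<and> matrix_inv M ** M = mat 1"
    using assms unfolding invertible_def matrix_inv_def by (rule someI_ex)
  then have "is_pinv M (matrix_inv M)"
    by (simp add: is_pinv_def)
  then show ?thesis
    by (rule pinv_unique[symmetric])
qed

lemma pos_def_invertible:
  assumes "pos_def M"
  shows "invertible M"
proof -
  have "v = 0" if "M *v v = 0" for v
    using assms that by (force simp: pos_def_def)
  then show ?thesis
    by (simp add: invertible_left_inverse matrix_left_invertible_ker)
qed


section \<open>The design\<close>

text \<open>A rank-one matrix \<open>outer_prod u u\<close> has the quadratic form
  \<open>(u \<bullet> v)\<^sup>2\<close>, so the information becomes a weighted sum of squares, as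
  in the second moment of the score.\<close>

lemma inner_fisher_info:
  fixes q :: "'d \<times> 'd \<Rightarrow> real^'k"
  shows "v \<bullet> (fisher_info Es n \<sigma> q \<eta> \<theta> *v v) = (1 / (real (sample_size Es n) * \<sigma>\<^sup>2)) *
    (\<Sum>\<alpha>\<in>Es. real (n \<alpha>) * (logistic (\<eta> \<alpha> \<theta>) * (1 - logistic (\<eta> \<alpha> \<theta>))) * (q \<alpha> \<bullet> v)\<^sup>2)"
proof -
  have mv_sum: "(\<Sum>\<alpha>\<in>Es. F \<alpha>) *v v = (\<Sum>\<alpha>\<in>Es. F \<alpha> *v v)" for F :: "'d \<times> 'd \<Rightarrow> real^'k^'k"
    by (induction Es rule: infinite_finite_induct) (simp_all add: matrix_vector_mult_add_rdistrib)
  have outer: "outer_prod u u *v v = (u \<bullet> v) *\<^sub>R u" for u :: "real^'k"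
    by (simp add: vec_eq_iff outer_prod_def matrix_vector_mult_def inner_vec_def sum_distrib_left mult_ac)
  show ?thesis
    unfolding fisher_info_def deriv2_log_partition
    by (simp add: scaleR_matrix_vector_assoc[symmetric] mv_sum outer inner_sum_right
        power2_eq_square inner_commute[of v] mult_ac)
qed

lemma transpose_fisher_info: "transpose (fisher_info Es n \<sigma> q \<eta> \<theta>) = fisher_info Es n \<sigma> q \<eta> \<theta>"
  by (simp add: fisher_info_def transpose_def vec_eq_iff outer_prod_def mult_ac)

lemma sum_design:
  "finite Es \<Longrightarrow> (\<Sum>z\<in>(SIGMA \<alpha>:Es. {1..n \<alpha>}). g (fst z)) = (\<Sum>\<alpha>\<in>Es. real (n \<alpha>) * g \<alpha>)"
  for g :: "_ \<Rightarrow> real"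
  using sum.Sigma[of Es "\<lambda>\<alpha>. {1..n \<alpha>}" "\<lambda>\<alpha> t. g \<alpha>"] by (simp add: case_prod_unfold)

lemma GDERIV_inner_left: "GDERIV (\<lambda>\<theta>. u \<bullet> \<theta>) \<theta> :> u"
  unfolding gderiv_def by (auto intro!: derivative_eq_intros simp: inner_commute)

text \<open>Gradients are unique. This identifies the matrix that \<open>locally_unbiased\<close>
  only asserts to exist.\<close>

lemma has_gradient_matrix_id: "has_gradient_matrix (\<lambda>\<theta>. \<theta>) \<theta> G \<longleftrightarrow> G = mat 1"
proof -
  have comp: "GDERIV (\<lambda>\<theta>. \<theta> $ k) \<theta> :> axis k 1" for k
    using GDERIV_inner_left[of "axis k 1" \<theta>] by (simp add: inner_axis')
  have col: "column k (mat 1) = axis k (1::real)" for k :: 'a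
    by (simp add: column_def mat_def axis_def vec_eq_iff)
  have "G = mat 1" if "\<And>k. GDERIV (\<lambda>\<theta>. \<theta> $ k) \<theta> :> column k G"
  proof -
    have "column k G = axis k 1" for k
      using has_derivative_unique[OF that[unfolded gderiv_def] comp[unfolded gderiv_def]]
      by (metis vector_eq_ldot)
    then show ?thesis
      by (simp add: vec_eq_iff column_def axis_def mat_def)
  qed
  then show ?thesis
    unfolding has_gradient_matrix_def by (auto simp: col comp)
qed

lemma C1_map_on_inner: "C1_map_on S (\<lambda>\<theta>. vec (u \<bullet> \<theta>) :: real^1)"
proof -
  let ?J = "(\<chi> i. u) :: real^'a^1"
  have "(\<lambda>\<theta>. vec (u \<bullet> \<theta>)) = (*v) ?J"
    by (simp add: fun_eq_iff vec_eq_iff matrix_vector_mult_def inner_vec_def)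
  then show ?thesis
    unfolding C1_map_on_def
    by (intro exI[of _ "\<lambda>_. ?J"])
       (simp add: bounded_linear_imp_has_derivative matrix_vector_mul_bounded_linear)
qed

theorem corollary3p1:
  fixes \<phi> :: "'x \<Rightarrow> real^'p"
    and x :: "'d::{finite,linorder} \<Rightarrow> 'x"
    and A :: "real^'p^'m"
    and b :: "real^'m"
    and V :: "real^'k^'p"
    and \<sigma> B :: real
    and Es :: "('d \<times> 'd) set"
    and n :: "'d \<times> 'd \<Rightarrow> nat"
    and a :: "'d \<times> 'd \<Rightarrow> real^'p"
    and q :: "'d \<times> 'd \<Rightarrow> real^'k"
    and \<eta> :: "'d \<times> 'd \<Rightarrow> real^'k \<Rightarrow> real"
    and P :: "real^'k \<Rightarrow> (('d \<times> 'd) \<times> nat \<Rightarrow> bool) pmf"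
    and \<Theta> :: "(real^'k) set"
    and \<I> :: "real^'k \<Rightarrow> real^'k^'k"
    and \<theta>' :: "real^'k"
    and est :: "(('d \<times> 'd) \<times> nat \<Rightarrow> bool) \<Rightarrow> real^'k"
  assumes d_ge_2: "CARD('d) \<ge> 2"
    and scale_pos: "\<sigma> > 0"
    and consistent: "\<exists>w. A *v w = b"
    and dim_theta: "CARD('k) = CARD('p) - rank A"
    and V_orthonormal: "\<forall>i j. column i V \<bullet> column j V = (if i = j then 1 else 0)"
    and V_span: "span (columns V) = {w. A *v w = 0}"
    and Es_nonempty: "Es \<noteq> {}"
    and Es_pairs: "Es \<subseteq> {(i, j). i < j}"
    and n_ge_1: "\<forall>\<alpha>\<in>Es. n \<alpha> \<ge> 1"
    and B_gt_1: "B > 1"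
    and a_eq: "a = contrast (feature_matrix \<phi> x)"
    and q_eq: "q = (\<lambda>\<alpha>. transpose V *v a \<alpha>)"
    and eta_eq: "\<eta> = (\<lambda>\<alpha> \<theta>. ((pinv A *v b) \<bullet> a \<alpha> + q \<alpha> \<bullet> \<theta>) / \<sigma>)"
    and P_eq: "P = btl_pmf Es n \<eta>"
    and Theta_eq: "\<Theta> = param_set Es \<eta> B"
    and I_eq: "\<I> = fisher_info Es n \<sigma> q \<eta>"
    and interior: "\<theta>' \<in> interior \<Theta>"
    and unbiased: "locally_unbiased \<Theta> P (\<lambda>\<theta>. \<theta>) est \<theta>'"
  shows "(\<forall>\<alpha>\<in>Es.
            locally_unbiased \<Theta> P (\<lambda>\<theta>. vec (q \<alpha> \<bullet> \<theta>) :: real^1) (\<lambda>Y. vec (q \<alpha> \<bullet> est Y)) \<theta>' \<and>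
            measure_pmf.expectation (P \<theta>') (\<lambda>Y. \<bar>q \<alpha> \<bullet> (est Y - \<theta>')\<bar>\<^sup>2)
              \<ge> (q \<alpha> \<bullet> (pinv (\<I> \<theta>') *v q \<alpha>)) / real (sample_size Es n)) \<and>
         (pos_def (\<I> \<theta>') \<longrightarrow>
            measure_pmf.expectation (P \<theta>') (\<lambda>Y. (norm (est Y - \<theta>'))\<^sup>2)
              \<ge> trace (matrix_inv (\<I> \<theta>')) / real (sample_size Es n))"
proof -
  have fin: "finite Es"
    by simp
  define Z where "Z = (SIGMA \<alpha>:Es. {1..n \<alpha>})"
  define c where "c z = ((pinv A *v b) \<bullet> a (fst z)) / \<sigma>" for z :: "('d \<times> 'd) \<times> nat"
  \<comment> \<open>The scale is absorbed into the covariates; squaring them yields the factor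
    \<open>1 / \<sigma>\<^sup>2\<close> of the information.\<close>
  define w where "w z = (1 / \<sigma>) *\<^sub>R q (fst z)" for z :: "('d \<times> 'd) \<times> nat"
  have Z: "finite Z"
    by (simp add: Z_def)
  have eta: "c z + w z \<bullet> \<theta> = \<eta> (fst z) \<theta>" for z \<theta>
    by (simp add: c_def w_def eta_eq add_divide_distrib)
  have P: "P \<theta> = logit_pmf Z c w \<theta>" for \<theta>
    by (simp add: P_eq btl_pmf_def logit_pmf_def eta logistic_def Z_def case_prod_unfold)
  let ?E = "\<lambda>\<theta>. measure_pmf.expectation (P \<theta>)"
  have int: "integrable (measure_pmf (P \<theta>)) f"
    for f :: "(('d \<times> 'd) \<times> nat \<Rightarrow> bool) \<Rightarrow> 'v::{banach,second_countable_topology}" and \<theta>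
    unfolding P by (rule integrable_logit_pmf[OF Z])

  obtain \<alpha>0 where "\<alpha>0 \<in> Es"
    using Es_nonempty by blast
  then have "sample_size Es n \<ge> 1"
    unfolding sample_size_def using n_ge_1 fin by (metis le_trans member_le_sum zero_le)
  then have N: "real (sample_size Es n) > 0"
    by simp
  let ?N = "real (sample_size Es n)"
  have information: "(\<Sum>z\<in>Z. logistic (c z + w z \<bullet> \<theta>') * (1 - logistic (c z + w z \<bullet> \<theta>')) * (w z \<bullet> v)\<^sup>2)
      = ?N * (v \<bullet> (\<I> \<theta>' *v v))" for v
  proof -
    have "(\<Sum>z\<in>Z. logistic (c z + w z \<bullet> \<theta>') * (1 - logistic (c z + w z \<bullet> \<theta>')) * (w z \<bullet> v)\<^sup>2) =
        (\<Sum>\<alpha>\<in>Es. real (n \<alpha>) *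
          (logistic (\<eta> \<alpha> \<theta>') * (1 - logistic (\<eta> \<alpha> \<theta>')) * ((1 / \<sigma>\<^sup>2) * (q \<alpha> \<bullet> v)\<^sup>2)))"
      unfolding eta Z_def sum_design[OF fin, symmetric]
      by (simp add: w_def power_mult_distrib power_divide)
    also have "\<dots> = ?N * (v \<bullet> (\<I> \<theta>' *v v))"
      using N scale_pos by (simp add: I_eq inner_fisher_info sum_distrib_left mult_ac)
    finally show ?thesis .
  qed
  have CR: "(u \<bullet> (pinv (\<I> \<theta>') *v u)) / ?N \<le> ?E \<theta>' (\<lambda>Y. (f Y - m)\<^sup>2)"
    if "GDERIV (\<lambda>\<theta>. ?E \<theta> f) \<theta>' :> u" for f u m
  proof -
    define r where "r = pinv (\<I> \<theta>') *v u"
    have r: "r \<bullet> (\<I> \<theta>' *v r) = u \<bullet> r"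
      unfolding r_def by (intro inner_pinv) (simp add: I_eq transpose_fisher_info)
    \<comment> \<open>In the direction \<open>r / N\<close> the linear term is
      \<open>2 * (u \<bullet> r) / N\<close> and, by \<open>r\<close>, the quadratic one is
      \<open>(u \<bullet> r) / N\<close>; half of the former survives.\<close>
    have "2 * (u \<bullet> ((1 / ?N) *\<^sub>R r)) - ?N * (((1 / ?N) *\<^sub>R r) \<bullet> (\<I> \<theta>' *v ((1 / ?N) *\<^sub>R r)))
        \<le> ?E \<theta>' (\<lambda>Y. (f Y - m)\<^sup>2)"
      using logit_Cramer_Rao[OF Z that[unfolded P], of "(1 / ?N) *\<^sub>R r" m]
      unfolding information P .
    also have "2 * (u \<bullet> ((1 / ?N) *\<^sub>R r)) - ?N * (((1 / ?N) *\<^sub>R r) \<bullet> (\<I> \<theta>' *v ((1 / ?N) *\<^sub>R r)))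
        = (u \<bullet> r) / ?N"
      using N by (simp add: matrix_vector_mult_scaleR r)
    finally show ?thesis
      by (simp add: r_def)
  qed

  from unbiased obtain G where mean: "?E \<theta>' est = \<theta>'"
    and G: "has_gradient_matrix (\<lambda>\<theta>. ?E \<theta> est) \<theta>' G" "has_gradient_matrix (\<lambda>\<theta>. \<theta>) \<theta>' G"
    unfolding locally_unbiased_def by blast
  have grad_k: "GDERIV (\<lambda>\<theta>. ?E \<theta> est $ k) \<theta>' :> axis k 1" for k
  proof -
    have "column k G = axis k 1"
      using G(2) by (simp add: has_gradient_matrix_id column_def mat_def axis_def vec_eq_iff)
    then show ?thesis
      using G(1) by (simp add: has_gradient_matrix_def) metis
  qed
  have E_inner: "?E \<theta> (\<lambda>Y. u \<bullet> est Y) = u \<bullet> ?E \<theta> est" for u \<theta>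
    by (simp add: int)
  \<comment> \<open>Local unbiasedness passes to every linear functional of the estimator by
    combining the coordinate gradients.\<close>
  have grad: "GDERIV (\<lambda>\<theta>. ?E \<theta> (\<lambda>Y. u \<bullet> est Y)) \<theta>' :> u" for u
  proof -
    have "((\<lambda>\<theta>. \<Sum>k\<in>UNIV. u $ k * (?E \<theta> est $ k)) has_derivative
        (\<lambda>h. \<Sum>k\<in>UNIV. u $ k * (h \<bullet> axis k 1))) (at \<theta>')"
      by (intro has_derivative_sum has_derivative_mult_right grad_k[unfolded gderiv_def])
    then show ?thesis
      unfolding gderiv_def E_inner by (simp add: inner_axis) (simp add: inner_vec_def mult.commute)
  qed
  \<comment> \<open>Stated for all \<open>u\<close>, since part (i) takes \<open>q \<alpha>\<close>
    and part (ii) the coordinate vectors.\<close>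
  have bound: "(u \<bullet> (pinv (\<I> \<theta>') *v u)) / ?N \<le> ?E \<theta>' (\<lambda>Y. (u \<bullet> (est Y - \<theta>'))\<^sup>2)" for u
    using CR[OF grad, of u "u \<bullet> \<theta>'"] by (simp add: inner_diff_right)

  have part1: "locally_unbiased \<Theta> P (\<lambda>\<theta>. vec (u \<bullet> \<theta>) :: real^1) (\<lambda>Y. vec (u \<bullet> est Y)) \<theta>'" for u
  proof -
    have E_vec: "?E \<theta> (\<lambda>Y. vec (u \<bullet> est Y) :: real^1) = vec (?E \<theta> (\<lambda>Y. u \<bullet> est Y))" for \<theta>
    proof -
      have "?E \<theta> (\<lambda>Y. vec (u \<bullet> est Y) :: real^1) $ k = ?E \<theta> (\<lambda>Y. u \<bullet> est Y)" for k
        using integral_bounded_linear[OF bounded_linear_vec_nth int, of \<theta> "\<lambda>Y. vec (u \<bullet> est Y)" k]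
        by simp
      then show ?thesis
        by (simp add: vec_eq_iff)
    qed
    \<comment> \<open>The common gradient matrix has the single column \<open>u\<close>.\<close>
    let ?G = "(\<chi> i j. u $ i) :: real^1^'k"
    have col: "column k ?G = u" for k
      by (simp add: column_def)
    have "has_gradient_matrix (\<lambda>\<theta>. ?E \<theta> (\<lambda>Y. vec (u \<bullet> est Y) :: real^1)) \<theta>' ?G"
      unfolding has_gradient_matrix_def col E_vec using grad by simp
    moreover have "has_gradient_matrix (\<lambda>\<theta>. vec (u \<bullet> \<theta>) :: real^1) \<theta>' ?G"
      unfolding has_gradient_matrix_def col by (simp add: GDERIV_inner_left)
    ultimately show ?thesis
      unfolding locally_unbiased_def using C1_map_on_inner
      by (auto simp: E_vec E_inner mean Suc_le_eq)
  qed

  have part2: "trace (matrix_inv (\<I> \<theta>')) / ?N \<le> ?E \<theta>' (\<lambda>Y. (norm (est Y - \<theta>'))\<^sup>2)"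
    if "pos_def (\<I> \<theta>')"
  proof -
    \<comment> \<open>The trace splits into the diagonal entries, each a quadratic form of the
      pseudoinverse at a coordinate vector; the matching squared errors add up to the squared
      norm.\<close>
    have "trace (matrix_inv (\<I> \<theta>')) / ?N =
        (\<Sum>k\<in>UNIV. (axis k 1 \<bullet> (pinv (\<I> \<theta>') *v axis k 1)) / ?N)"
      using pos_def_invertible[OF that]
      by (simp add: matrix_inv_eq_pinv trace_def sum_divide_distrib inner_axis'
          matrix_vector_mul_component inner_axis)
    also have "\<dots> \<le> (\<Sum>k\<in>UNIV. ?E \<theta>' (\<lambda>Y. (axis k 1 \<bullet> (est Y - \<theta>'))\<^sup>2))"
      by (intro sum_mono bound)
    also have "\<dots> = ?E \<theta>' (\<lambda>Y. \<Sum>k\<in>UNIV. (axis k 1 \<bullet> (est Y - \<theta>'))\<^sup>2)"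
      by (intro Bochner_Integration.integral_sum[symmetric] int)
    also have "\<dots> = ?E \<theta>' (\<lambda>Y. (norm (est Y - \<theta>'))\<^sup>2)"
      by (simp add: power2_norm_eq_inner inner_axis') (simp add: inner_vec_def power2_eq_square)
    finally show ?thesis .
  qed
  show ?thesis
    using part1 bound part2 by simp
qed

end
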